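(* Consider the Kadanoff sand pile model KSPM(3), i.e. with parameter $D=3$. There exists a function $N\mapsto i(N)$ with $i(N)=O(\log N)$ such that for every $N$ the tail $\pi(N)_{[i(N),\infty[}=(\pi(N)_{i(N)},\pi(N)_{i(N)+1},\dots)$ belongs to $(2,1)^*[0](2,1)^*0^\omega$. Equivalently, there are integers $m,m'\ge 0$ and $e\in\{0,1\}$ such that this tail equals $(2,1)^m$, followed by $e$ copies of $0$, followed by $(2,1)^{m'}$, followed by zeros forever.
   Context: KSPM($D$), for an integer parameter $D\ge 2$, is defined as follows. A configuration is an ultimately null sequence $\sigma=(\sigma_0,\sigma_1,\dots)$ of nonnegative integers. Here $\sigma_i=h_i-h_{i+1}$ is the height difference between columns $i$ and $i+1$ of a sand pile. There is a transition $\sigma\to\sigma'$ on column $i$ when $\sigma_i\ge D$ and: - $\sigma'_{i-1}=\sigma_{i-1}+D-1$ (if $i\ne 0$), - $\sigma'_i=\sigma_i-D$, - $\sigma'_{i+D-1}=\sigma_{i+D-1}+1$, - $\sigma'_j=\sigma_j$ for all other $j$. A configuration is stable (a fixed point) if no transition applies. From every configuration $\sigma$, every maximal sequence of transitions ends in the same stable configuration $\pi(\sigma)$. We write $\pi(N)=\pi((N,0,0,\dots))$, the fixed point reached from $N$ grains stacked on column $0$. Notation: $0^\omega$ denotes the infinite sequence of zeros, $(2,1)^*$ denotes any finite number of repetitions of the block $2,1$, and $[0]$ denotes at most one $0$. *)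

theory Defs
  imports "HOL-Library.Landau_Symbols" "HOL-Library.More_List"
begin

text \<open>
  A configuration is given by its height differences \<open>\<sigma> i = h i - h (i + 1)\<close>.
  The parameter \<open>D\<close> is meant to be at least 2, which makes the three columns changed by a
  transition distinct.
\<close>

definition configuration :: "(nat \<Rightarrow> nat) \<Rightarrow> bool" where
  "configuration \<sigma> \<longleftrightarrow> (\<exists>n. \<forall>j\<ge>n. \<sigma> j = 0)"

text \<open>For \<open>i = 0\<close> the first case below never applies.\<close>

definition fire :: "nat \<Rightarrow> nat \<Rightarrow> (nat \<Rightarrow> nat) \<Rightarrow> (nat \<Rightarrow> nat)" where
  "fire D i \<sigma> = (\<lambda>j.
     if j + 1 = i then \<sigma> j + (D - 1)
     else if j = i then \<sigma> j - D
     else if j = i + (D - 1) then \<sigma> j + 1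
     else \<sigma> j)"

definition kspm_step :: "nat \<Rightarrow> (nat \<Rightarrow> nat) \<Rightarrow> (nat \<Rightarrow> nat) \<Rightarrow> bool" where
  "kspm_step D \<sigma> \<sigma>' \<longleftrightarrow> configuration \<sigma> \<and> (\<exists>i. \<sigma> i \<ge> D \<and> \<sigma>' = fire D i \<sigma>)"

definition stable :: "nat \<Rightarrow> (nat \<Rightarrow> nat) \<Rightarrow> bool" where
  "stable D \<sigma> \<longleftrightarrow> \<not> (\<exists>\<sigma>'. kspm_step D \<sigma> \<sigma>')"

text \<open>
  For \<open>D \<ge> 2\<close> the model terminates and is confluent, so that the description below determines
  a unique stable configuration whenever \<open>\<sigma>\<close> is a configuration.
\<close>

definition fixed_point :: "nat \<Rightarrow> (nat \<Rightarrow> nat) \<Rightarrow> (nat \<Rightarrow> nat)" where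
  "fixed_point D \<sigma> = (THE \<tau>. (kspm_step D)\<^sup>*\<^sup>* \<sigma> \<tau> \<and> stable D \<tau>)"

definition grains :: "nat \<Rightarrow> (nat \<Rightarrow> nat)" where
  "grains N = (\<lambda>j. if j = 0 then N else 0)"

definition kspm_pi :: "nat \<Rightarrow> nat \<Rightarrow> (nat \<Rightarrow> nat)" where
  "kspm_pi D N = fixed_point D (grains N)"

definition tail_from :: "nat \<Rightarrow> (nat \<Rightarrow> nat) \<Rightarrow> (nat \<Rightarrow> nat)" where
  "tail_from i \<sigma> = (\<lambda>k. \<sigma> (i + k))"

text \<open>
  The set \<open>(2,1)\<^sup>* [0] (2,1)\<^sup>* 0\<^sup>\<omega>\<close>; the term \<open>nth_default 0 w\<close> is the finite word \<open>w\<close>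
  followed by zeros forever.
\<close>

definition wave_pattern :: "(nat \<Rightarrow> nat) set" where
  "wave_pattern =
     {nth_default 0 (concat (replicate m [2, 1]) @ replicate e 0 @ concat (replicate m' [2, 1]))
       | m e m'. e \<le> 1}"

end

theory Submission
  imports Defs "HOL-Library.Confluence" "HOL-Library.Log_Nat"
begin

text \<open>
  Add the grains one at a time. The avalanche caused by one grain fires every column at most once,
  and the curvature \<open>d\<^sub>j = 2 a\<^sub>j - a\<^sub>j\<^sub>-\<^sub>1 - a\<^sub>j\<^sub>+\<^sub>1\<close> of the total number \<open>a\<^sub>j\<close> of firings satisfies
  \<open>2 d\<^sub>j\<^sub>+\<^sub>1 = - d\<^sub>j - \<pi>(N)\<^sub>j\<^sub>+\<^sub>1\<close>. As \<open>\<pi>(N)\<close> takes its values in \<open>{0,1,2}\<close>, this recurrence is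
  contracting: beyond a column \<open>B = O(log N)\<close> only \<open>d\<^sub>j \<in> {-1,0}\<close> is possible, which makes the tail of
  \<open>\<pi>(N)\<close> a concatenation of blocks \<open>2,1\<close> and \<open>0\<close>. Fix \<open>B\<close> for all piles with at most \<open>N\<close> grains.
  Beyond \<open>B\<close> the columns fired by an avalanche form an interval, which ends before the first zero;
  so the avalanche can only exchange the first block \<open>2,1,0\<close> for \<open>0,2,1\<close> or add to the tail at
  its left end. Hence the tail never has two zeros in front of a block \<open>2,1\<close>.
\<close>

section \<open>Termination and uniqueness\<close>

lemma configuration_fire: "configuration \<sigma> \<Longrightarrow> configuration (fire D i \<sigma>)"
  unfolding configuration_def
proof (elim exE)
  fix n assume n: "\<forall>j\<ge>n. \<sigma> j = 0"
  then have "\<forall>j \<ge> n + i + D + 1. fire D i \<sigma> j = 0"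
    by (auto simp: fire_def)
  then show "\<exists>n. \<forall>j\<ge>n. fire D i \<sigma> j = 0" ..
qed

lemma configuration_add:
  assumes "configuration \<sigma>" "configuration \<tau>"
  shows "configuration (\<lambda>j. \<sigma> j + \<tau> j)"
proof -
  obtain m n where "\<forall>j\<ge>m. \<sigma> j = 0" "\<forall>j\<ge>n. \<tau> j = 0"
    using assms unfolding configuration_def by blast
  then have "\<forall>j\<ge>max m n. \<sigma> j + \<tau> j = 0" by simp
  then show ?thesis unfolding configuration_def by blast
qed

lemma configuration_grains: "configuration (grains N)"
  unfolding configuration_def grains_def by (intro exI[of _ 1]) auto

lemma configuration_steps: "(kspm_step D)\<^sup>*\<^sup>* \<sigma> \<tau> \<Longrightarrow> configuration \<sigma> \<Longrightarrow> configuration \<tau>"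
  by (induction rule: rtranclp_induct) (auto simp: kspm_step_def configuration_fire)

lemma fire_ge: "i \<noteq> j \<Longrightarrow> \<sigma> j \<le> fire D i \<sigma> j"
  by (auto simp: fire_def)

lemma fire_commute:
  assumes "i \<noteq> j" "3 \<le> \<sigma> i" "3 \<le> \<sigma> j"
  shows "fire 3 i (fire 3 j \<sigma>) = fire 3 j (fire 3 i \<sigma>)"
  using assms by (intro ext) (auto simp: fire_def)

text \<open>Firing one column never lowers another, so two enabled columns stay enabled after each
  other and close a diamond.\<close>

lemma strong_confluentp_kspm_step: "strong_confluentp (kspm_step 3)"
proof
  fix \<sigma> \<tau> \<upsilon> assume st: "kspm_step 3 \<sigma> \<tau>" "kspm_step 3 \<sigma> \<upsilon>"
  then obtain i j where *: "configuration \<sigma>" "3 \<le> \<sigma> i" "3 \<le> \<sigma> j" "\<tau> = fire 3 i \<sigma>" "\<upsilon> = fire 3 j \<sigma>"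
    unfolding kspm_step_def by blast
  show "\<exists>u. (kspm_step 3)\<^sup>*\<^sup>* \<tau> u \<and> (kspm_step 3)\<^sup>=\<^sup>= \<upsilon> u"
  proof (cases "i = j")
    case True
    then show ?thesis using * by blast
  next
    case False
    have "kspm_step 3 \<tau> (fire 3 j \<tau>)" "kspm_step 3 \<upsilon> (fire 3 i \<upsilon>)"
      using * False fire_ge[of i j \<sigma> 3] fire_ge[of j i \<sigma> 3]
      unfolding kspm_step_def by (auto simp: configuration_fire intro: order_trans)
    moreover have "fire 3 j \<tau> = fire 3 i \<upsilon>"
      using * False fire_commute[of i j \<sigma>] by simp
    ultimately show ?thesis by auto
  qed
qed

lemma stable_steps_eq: "stable D \<sigma> \<Longrightarrow> (kspm_step D)\<^sup>*\<^sup>* \<sigma> \<tau> \<Longrightarrow> \<tau> = \<sigma>"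
  by (metis converse_rtranclpE stable_def)

lemma fixed_point_eqI:
  assumes "(kspm_step 3)\<^sup>*\<^sup>* \<sigma> \<tau>" "stable 3 \<tau>"
  shows "fixed_point 3 \<sigma> = \<tau>"
  unfolding fixed_point_def
proof (rule the_equality)
  fix \<upsilon> assume "(kspm_step 3)\<^sup>*\<^sup>* \<sigma> \<upsilon> \<and> stable 3 \<upsilon>"
  moreover have "confluentp (kspm_step 3)"
    by (simp add: strong_confluentp_imp_confluentp strong_confluentp_kspm_step)
  ultimately show "\<upsilon> = \<tau>"
    using assms by (metis confluentpD stable_steps_eq)
qed (use assms in simp)

lemma stable_iff: "configuration \<sigma> \<Longrightarrow> stable D \<sigma> \<longleftrightarrow> (\<forall>j. \<sigma> j < D)"
  by (auto simp: stable_def kspm_step_def not_le)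

lemma stable_grains_0: "D > 0 \<Longrightarrow> stable D (grains 0)"
  using stable_iff[OF configuration_grains, of D 0] by (simp add: grains_def)

lemma fire_add: "D \<le> \<sigma> i \<Longrightarrow> fire D i (\<lambda>j. \<sigma> j + \<tau> j) = (\<lambda>j. fire D i \<sigma> j + \<tau> j)"
  by (auto simp: fire_def)

text \<open>Extra content keeps every firing legal. Hence \<open>N + 1\<close> grains may be
  stabilised by treating \<open>N\<close> of them first and then dropping the last one.\<close>

lemma steps_add:
  assumes "(kspm_step D)\<^sup>*\<^sup>* \<sigma> \<sigma>'" "configuration \<tau>"
  shows "(kspm_step D)\<^sup>*\<^sup>* (\<lambda>j. \<sigma> j + \<tau> j) (\<lambda>j. \<sigma>' j + \<tau> j)"
  using assms(1)
proof (induction rule: rtranclp_induct)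
  case (step \<sigma>' \<sigma>'')
  from step(2) obtain i where i: "configuration \<sigma>'" "D \<le> \<sigma>' i" "\<sigma>'' = fire D i \<sigma>'"
    unfolding kspm_step_def by blast
  have "kspm_step D (\<lambda>j. \<sigma>' j + \<tau> j) (\<lambda>j. \<sigma>'' j + \<tau> j)"
    unfolding kspm_step_def
  proof (intro conjI exI)
    show "configuration (\<lambda>j. \<sigma>' j + \<tau> j)"
      using i(1) assms(2) by (rule configuration_add)
    show "D \<le> \<sigma>' i + \<tau> i" using i by simp
    show "(\<lambda>j. \<sigma>'' j + \<tau> j) = fire D i (\<lambda>j. \<sigma>' j + \<tau> j)"
      using i fire_add[of D \<sigma>' i \<tau>] by simp
  qed
  with step.IH show ?case by simp
qed simp

section \<open>Avalanches\<close>

text \<open>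
  The content of column \<open>j\<close> after one grain has been added to \<open>\<sigma>\<close> on column 0 and the columns in
  \<open>S\<close> have fired once, before the loss due to the firing of \<open>j\<close> itself is taken into account.
\<close>

definition load :: "(nat \<Rightarrow> nat) \<Rightarrow> nat set \<Rightarrow> nat \<Rightarrow> nat" where
  "load \<sigma> S j = \<sigma> j + of_bool (j = 0 \<or> 2 \<le> j \<and> j - 2 \<in> S) + 2 * of_bool (Suc j \<in> S)"

definition topple :: "(nat \<Rightarrow> nat) \<Rightarrow> nat set \<Rightarrow> nat \<Rightarrow> nat" where
  "topple \<sigma> S j = load \<sigma> S j - 3 * of_bool (j \<in> S)"

text \<open>Only the set of fired columns is kept, not their order: \<open>topple\<close> depends on
  the set alone, and \<open>j \<notin> S\<close> makes each column fire at most once.\<close>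

inductive avalanche :: "(nat \<Rightarrow> nat) \<Rightarrow> nat set \<Rightarrow> bool" for \<sigma> where
  empty: "avalanche \<sigma> {}"
| insert: "avalanche \<sigma> S \<Longrightarrow> j \<notin> S \<Longrightarrow> 3 \<le> load \<sigma> S j \<Longrightarrow> avalanche \<sigma> (insert j S)"

lemma load_mono: "S \<subseteq> T \<Longrightarrow> load \<sigma> S j \<le> load \<sigma> T j"
  unfolding load_def by (intro add_mono mult_left_mono) auto

lemma load_insert:
  "j \<notin> S \<Longrightarrow> load \<sigma> (insert j S) i = load \<sigma> S i + 2 * of_bool (Suc i = j) + of_bool (i = j + 2)"
  by (cases "i = j + 2") (auto simp: load_def)

lemma avalanche_finite: "avalanche \<sigma> S \<Longrightarrow> finite S"
  by (induction rule: avalanche.induct) auto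

lemma avalanche_load: "avalanche \<sigma> S \<Longrightarrow> j \<in> S \<Longrightarrow> 3 \<le> load \<sigma> S j"
proof (induction rule: avalanche.induct)
  case (insert S i)
  then have "3 \<le> load \<sigma> S j" by auto
  also have "\<dots> \<le> load \<sigma> (insert i S) j" by (rule load_mono) auto
  finally show ?case .
qed simp

text \<open>The column found here is the first column of \<open>T\<close> that fires.\<close>

lemma avalanche_first:
  "avalanche \<sigma> S \<Longrightarrow> S \<inter> T \<noteq> {} \<Longrightarrow> \<exists>c\<in>S \<inter> T. 3 \<le> load \<sigma> (S - T) c"
proof (induction rule: avalanche.induct)
  case (insert S j)
  show ?case
  proof (cases "S \<inter> T = {}")
    case True
    with insert have "j \<in> T" "insert j S - T = S" by auto
    with insert show ?thesis by auto
  next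
    case False
    then obtain c where "c \<in> S \<inter> T" "3 \<le> load \<sigma> (S - T) c" using insert by auto
    moreover have "load \<sigma> (S - T) c \<le> load \<sigma> (insert j S - T) c" by (rule load_mono) auto
    ultimately show ?thesis by (auto intro: order_trans)
  qed
qed simp

lemma steps_topple:
  assumes "configuration \<sigma>" "avalanche \<sigma> S"
  shows "(kspm_step 3)\<^sup>*\<^sup>* (\<lambda>j. \<sigma> j + grains 1 j) (topple \<sigma> S)"
  using assms(2)
proof (induction rule: avalanche.induct)
  case empty
  have "(\<lambda>j. \<sigma> j + grains 1 j) = topple \<sigma> {}"
    by (auto simp: topple_def load_def grains_def)
  then show ?case by simp
next
  case (insert S j)
  have "configuration (topple \<sigma> S)"
    using insert.IH assms(1) configuration_add configuration_grains configuration_steps by blast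
  moreover have "3 \<le> topple \<sigma> S j"
    using insert by (simp add: topple_def)
  moreover have "topple \<sigma> (insert j S) = fire 3 j (topple \<sigma> S)"
  proof
    fix i
    have "i \<in> S \<Longrightarrow> 3 \<le> load \<sigma> S i"
      using insert avalanche_load by blast
    then show "topple \<sigma> (insert j S) i = fire 3 j (topple \<sigma> S) i"
      using \<open>j \<notin> S\<close> by (cases "i \<in> S") (auto simp: topple_def load_insert fire_def)
  qed
  ultimately have "kspm_step 3 (topple \<sigma> S) (topple \<sigma> (insert j S))"
    unfolding kspm_step_def by blast
  with insert.IH show ?case by simp
qed

text \<open>A firing feeds the left neighbour and the second column to the right. Two adjacent
  unfired columns are thus a barrier: the first column beyond them to fire would hold only its old
  content.\<close>

lemma avalanche_stops:
  assumes "avalanche \<sigma> S" "\<And>j. \<sigma> j \<le> 2" "i \<notin> S" "Suc i \<notin> S"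
  shows "S \<inter> {i..} = {}"
proof (rule ccontr)
  assume "S \<inter> {i..} \<noteq> {}"
  then obtain c where c: "c \<in> S" "i \<le> c" "3 \<le> load \<sigma> (S - {i..}) c"
    using avalanche_first[OF assms(1), of "{i..}"] by auto
  moreover have "c \<noteq> i" "c \<noteq> Suc i" using c assms by auto
  ultimately have "load \<sigma> (S - {i..}) c = \<sigma> c" by (auto simp: load_def)
  with c(3) assms(2)[of c] show False by simp
qed

text \<open>The first column outside the support to fire would hold at most the single unit received
  from two columns to its left.\<close>

lemma avalanche_bounded:
  assumes "avalanche \<sigma> S" "\<And>j. j \<ge> n \<Longrightarrow> \<sigma> j = 0" "n \<noteq> 0"
  shows "S \<subseteq> {..<n}"
proof (rule ccontr)
  assume "\<not> S \<subseteq> {..<n}"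
  then have "S \<inter> {n..} \<noteq> {}" by (auto simp: not_less)
  then obtain c where c: "n \<le> c" "3 \<le> load \<sigma> (S - {n..}) c"
    using avalanche_first[OF assms(1), of "{n..}"] by auto
  with assms(2)[of c] show False by (auto simp: load_def of_bool_def split: if_splits)
qed

text \<open>Take an avalanche that is maximal under inclusion; maximality settles the unfired
  columns.\<close>

lemma stable_topple_exists:
  assumes "configuration \<sigma>" "\<And>j. \<sigma> j \<le> 2"
  obtains S where "avalanche \<sigma> S" "\<And>j. topple \<sigma> S j \<le> 2"
proof -
  obtain n where n: "\<forall>j\<ge>n. \<sigma> j = 0" using assms(1) unfolding configuration_def by blast
  have "{S. avalanche \<sigma> S} \<subseteq> Pow {..<Suc n}"
    using avalanche_bounded[of \<sigma> _ "Suc n"] n by auto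
  then have "finite {S. avalanche \<sigma> S}" by (rule finite_subset) simp
  then obtain S where S: "avalanche \<sigma> S" "\<And>T. avalanche \<sigma> T \<Longrightarrow> S \<subseteq> T \<Longrightarrow> S = T"
    using finite_has_maximal[of "{S. avalanche \<sigma> S}"] avalanche.empty by blast
  have "topple \<sigma> S j \<le> 2" for j
  proof (cases "j \<in> S")
    case True
    \<comment> \<open>The load is at most 2 + 1 + 2 = 5, so a single firing is enough.\<close>
    then show ?thesis using assms(2)[of j] by (auto simp: topple_def load_def)
  next
    case False
    have "load \<sigma> S j \<le> 2"
    proof (rule ccontr)
      assume "\<not> load \<sigma> S j \<le> 2"
      then have "avalanche \<sigma> (insert j S)" using S(1) False by (intro avalanche.insert) auto
      with S(2) False show False by blast
    qed
    then show ?thesis by (simp add: topple_def)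
  qed
  with S(1) show thesis by (rule that)
qed

section \<open>Building the piles grain by grain\<close>

lemma kspm_pi_steps:
  "(kspm_step 3)\<^sup>*\<^sup>* (grains N) (kspm_pi 3 N) \<and> (\<forall>j. kspm_pi 3 N j \<le> 2) \<and>
   (\<exists>S. avalanche (kspm_pi 3 N) S \<and> kspm_pi 3 (Suc N) = topple (kspm_pi 3 N) S)"
proof -
  have next_pile: "\<exists>S. avalanche \<sigma> S \<and> (\<forall>j. topple \<sigma> S j \<le> 2) \<and>
      kspm_pi 3 (Suc n) = topple \<sigma> S \<and> (kspm_step 3)\<^sup>*\<^sup>* (grains (Suc n)) (topple \<sigma> S)"
    if \<sigma>: "(kspm_step 3)\<^sup>*\<^sup>* (grains n) \<sigma>" "\<And>j. \<sigma> j \<le> 2" for n \<sigma>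
  proof -
    have conf: "configuration \<sigma>" using \<sigma>(1) configuration_grains configuration_steps by blast
    with \<sigma>(2) obtain S where S: "avalanche \<sigma> S" "\<And>j. topple \<sigma> S j \<le> 2"
      using stable_topple_exists by blast
    have "grains (Suc n) = (\<lambda>j. grains n j + grains 1 j)" by (auto simp: grains_def)
    then have steps: "(kspm_step 3)\<^sup>*\<^sup>* (grains (Suc n)) (topple \<sigma> S)"
      using steps_add[OF \<sigma>(1) configuration_grains[of 1]] steps_topple[OF conf S(1)] by simp
    moreover have "stable 3 (topple \<sigma> S)"
      using S(2) stable_iff[of _ 3] configuration_steps[OF steps configuration_grains]
      by (simp add: less_Suc_eq_le numeral_3_eq_3 numeral_2_eq_2)
    \<comment> \<open>Reachable and stable, so by confluence this is the pile of
      \<open>Suc n\<close> grains.\<close>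
    ultimately show ?thesis using S fixed_point_eqI unfolding kspm_pi_def by blast
  qed
  have "(kspm_step 3)\<^sup>*\<^sup>* (grains N) (kspm_pi 3 N) \<and> (\<forall>j. kspm_pi 3 N j \<le> 2)"
  proof (induction N)
    case 0
    have "kspm_pi 3 0 = grains 0"
      unfolding kspm_pi_def using stable_grains_0 by (intro fixed_point_eqI) auto
    then show ?case by (simp add: grains_def)
  next
    case (Suc N)
    then show ?case using next_pile[of N "kspm_pi 3 N"] by auto
  qed
  then show ?thesis using next_pile[of N "kspm_pi 3 N"] by auto
qed

lemma kspm_pi_le_2: "kspm_pi 3 N j \<le> 2"
  using kspm_pi_steps by blast

lemma kspm_pi_0: "kspm_pi 3 0 j = 0"
proof -
  have "kspm_pi 3 0 = grains 0"
  proof (rule stable_steps_eq)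
    show "stable 3 (grains 0)" by (simp add: stable_grains_0)
    show "(kspm_step 3)\<^sup>*\<^sup>* (grains 0) (kspm_pi 3 0)"
      by (rule conjunct1[OF kspm_pi_steps])
  qed
  then show ?thesis by (simp add: grains_def)
qed

lemma configuration_kspm_pi: "configuration (kspm_pi 3 N)"
  using kspm_pi_steps configuration_steps configuration_grains by blast

definition fired :: "nat \<Rightarrow> nat set" where
  "fired N = (SOME S. avalanche (kspm_pi 3 N) S \<and> kspm_pi 3 (Suc N) = topple (kspm_pi 3 N) S)"

lemma fired:
  "avalanche (kspm_pi 3 N) (fired N)" "kspm_pi 3 (Suc N) = topple (kspm_pi 3 N) (fired N)"
  using someI_ex[of "\<lambda>S. avalanche (kspm_pi 3 N) S \<and> kspm_pi 3 (Suc N) = topple (kspm_pi 3 N) S"]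
    kspm_pi_steps[of N] unfolding fired_def by blast+

lemma kspm_pi_Suc_int:
  "int (kspm_pi 3 (Suc N) j) = int (kspm_pi 3 N j) + of_bool (j = 0 \<or> 2 \<le> j \<and> j - 2 \<in> fired N)
     + 2 * of_bool (Suc j \<in> fired N) - 3 * of_bool (j \<in> fired N)"
proof -
  \<comment> \<open>Fired columns carry a load of at least 3, so the subtraction on naturals is
    exact.\<close>
  have "int (kspm_pi 3 (Suc N) j) = int (load (kspm_pi 3 N) (fired N) j) - 3 * of_bool (j \<in> fired N)"
    using avalanche_load[OF fired(1), of j N] by (auto simp: fired(2) topple_def of_nat_diff)
  then show ?thesis by (simp add: load_def)
qed

section \<open>Curvature of the shot vector\<close>

text \<open>Each summand is the contribution of one grain, so \<open>curv_Suc\<close> isolates the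
  last avalanche. The guard \<open>1 \<le> j\<close> lets column -1 count as never firing.\<close>

definition curv :: "nat \<Rightarrow> nat \<Rightarrow> int" where
  "curv N j = (\<Sum>n<N. 2 * of_bool (j \<in> fired n) - of_bool (Suc j \<in> fired n)
                 - of_bool (1 \<le> j \<and> j - 1 \<in> fired n))"

lemma curv_Suc:
  "curv (Suc N) j = curv N j + 2 * of_bool (j \<in> fired N) - of_bool (Suc j \<in> fired N)
     - of_bool (1 \<le> j \<and> j - 1 \<in> fired N)"
  by (simp add: curv_def)

text \<open>Balance of column \<open>j + 1\<close>: it holds
  \<open>a_{j-1} - 3 a_{j+1} + 2 a_{j+2}\<close>, which is \<open>- d_j - 2 d_{j+1}\<close>.\<close>

lemma curv_rec: "2 * curv N (Suc j) = - curv N j - int (kspm_pi 3 N (Suc j))"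
proof (induction N)
  case 0
  show ?case by (simp add: curv_def kspm_pi_0)
next
  case (Suc N)
  have "(2 \<le> Suc j \<and> Suc j - 2 \<in> fired N) = (1 \<le> j \<and> j - 1 \<in> fired N)"
    by (cases j) auto
  then show ?case using Suc by (simp add: curv_Suc kspm_pi_Suc_int)
qed

lemma curv_0_bound: "\<bar>curv N 0\<bar> \<le> 2 * int N"
  by (induction N) (auto simp: curv_Suc curv_def)

text \<open>The recurrence gives \<open>|d_{j+1}| \<le> (|d_j| + 2) / 2\<close>. This bound has
  fixed point 2, and the excess over 2 is at least halved at each column.\<close>

lemma curv_bound: "(\<bar>curv N j\<bar> - 2) * 2 ^ j \<le> \<bar>curv N 0\<bar>"
proof (induction j)
  case (Suc j)
  have "2 * (\<bar>curv N (Suc j)\<bar> - 2) \<le> \<bar>curv N j\<bar> - 2"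
    using curv_rec[of N j] kspm_pi_le_2[of N "Suc j"] by presburger
  then have "2 * (\<bar>curv N (Suc j)\<bar> - 2) * 2 ^ j \<le> (\<bar>curv N j\<bar> - 2) * 2 ^ j"
    by (intro mult_right_mono) auto
  with Suc show ?case by (simp add: algebra_simps)
qed simp

lemma curv_le_2:
  assumes "2 * N < 2 ^ j"
  shows "\<bar>curv N j\<bar> \<le> 2"
proof (rule ccontr)
  assume "\<not> \<bar>curv N j\<bar> \<le> 2"
  then have "1 * 2 ^ j \<le> (\<bar>curv N j\<bar> - 2) * 2 ^ j" by (intro mult_right_mono) auto
  also have "\<dots> \<le> 2 * int N" using curv_bound curv_0_bound by (rule order_trans)
  also have "\<dots> < 2 ^ j" using assms by (metis of_nat_less_iff of_nat_mult of_nat_numeral of_nat_power)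
  finally show False by simp
qed

text \<open>Once the contraction has reached [-2,2], rounding in the recurrence shrinks the range
  further, to [-2,1], [-1,1] and [-1,0]: three more columns.\<close>

lemma curv_confined:
  assumes "2 * N < 2 ^ j"
  shows "curv N (Suc (Suc (Suc j))) \<in> {-1, 0}"
proof -
  have "\<bar>curv N j\<bar> \<le> 2" using assms by (rule curv_le_2)
  then have "\<bar>curv N (Suc j)\<bar> \<le> 2 \<and> curv N (Suc j) \<noteq> 2"
    using curv_rec[of N j] kspm_pi_le_2[of N "Suc j"] by presburger
  then have "\<bar>curv N (Suc (Suc j))\<bar> \<le> 1"
    using curv_rec[of N "Suc j"] kspm_pi_le_2[of N "Suc (Suc j)"] by presburger
  then show ?thesis
    using curv_rec[of N "Suc (Suc j)"] kspm_pi_le_2[of N "Suc (Suc (Suc j))"] by simp presburger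
qed

definition confined :: "nat \<Rightarrow> nat \<Rightarrow> bool" where
  "confined B N \<longleftrightarrow> (\<forall>j\<ge>B. curv N j \<in> {-1, 0})"

text \<open>A two-state automaton reading the pile: in state 0 the letter 0 stays and the letter 2
  leads to state -1, where only the letter 1 is possible and leads back. So 2 and 1 occur in
  pairs.\<close>

lemma confined_cases:
  assumes "confined B N" "j \<ge> B"
  shows "curv N j = -1 \<and> curv N (Suc j) = 0 \<and> kspm_pi 3 N (Suc j) = 1 \<or>
    curv N j = 0 \<and> curv N (Suc j) = 0 \<and> kspm_pi 3 N (Suc j) = 0 \<or>
    curv N j = 0 \<and> curv N (Suc j) = -1 \<and> kspm_pi 3 N (Suc j) = 2"
proof -
  have "curv N j \<in> {-1, 0}" "curv N (Suc j) \<in> {-1, 0}"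
    using assms by (auto simp: confined_def)
  then show ?thesis using curv_rec[of N j] kspm_pi_le_2[of N "Suc j"] by auto
qed

section \<open>Effect of an avalanche on the tail\<close>

text \<open>The column before a zero cannot hold 2, which would need a 1 after it. Holding at most
  1, it cannot reach 3 with one unit from the left, and neither can the zero; columns further right
  receive nothing.\<close>

lemma fired_stops_before_zero:
  assumes "confined B N" "x \<ge> B" "kspm_pi 3 N (Suc (Suc x)) = 0"
  shows "fired N \<inter> {Suc x..} = {}"
proof (rule ccontr)
  let ?T = "{Suc x..}"
  assume "fired N \<inter> ?T \<noteq> {}"
  then obtain c where c: "c \<ge> Suc x" "3 \<le> load (kspm_pi 3 N) (fired N - ?T) c"
    using avalanche_first[OF fired(1), of N ?T] by auto
  have "kspm_pi 3 N (Suc x) \<le> 1"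
    using confined_cases[of B N x] confined_cases[of B N "Suc x"] assms by auto
  with c assms(3) kspm_pi_le_2[of N c] show False
    by (cases "c = Suc x"; cases "c = Suc (Suc x)") (auto simp: load_def of_bool_def split: if_splits)
qed

text \<open>If \<open>x\<close> is skipped but \<open>Suc x\<close> fires, then \<open>x - 1\<close>
  fires too, as otherwise there is a barrier. Then the curvature at \<open>x\<close> drops by 2,
  which the range {-1,0} forbids. So \<open>x\<close> and \<open>Suc x\<close> form a
  barrier.\<close>

lemma fired_interval:
  assumes "confined B N" "confined B (Suc N)"
    and "x > B" "x \<notin> fired N" "x \<le> y"
  shows "y \<notin> fired N"
proof -
  have "Suc x \<notin> fired N"
  proof
    assume "Suc x \<in> fired N"
    moreover from this have "x - 1 \<in> fired N"
      using avalanche_stops[OF fired(1), of N "x - 1"] kspm_pi_le_2 assms(3,4) by fastforce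
    ultimately have "curv (Suc N) x = curv N x - 2"
      using assms(3,4) by (simp add: curv_Suc)
    moreover have "curv N x \<in> {-1, 0}" "curv (Suc N) x \<in> {-1, 0}" 
      using assms(1-3) by (auto simp: confined_def)
    ultimately show False by auto
  qed
  then show ?thesis
    using avalanche_stops[OF fired(1), of N x] kspm_pi_le_2 assms(4,5) by fastforce
qed

text \<open>Inside an interval of fired columns gains and losses cancel, 1 + 2 - 3 = 0; only the
  right end \<open>j\<close> leaves a trace.\<close>

lemma avalanche_effect:
  assumes "confined B N" "confined B (Suc N)"
  shows "(\<forall>x\<ge>B + 3. kspm_pi 3 (Suc N) x = kspm_pi 3 N x) \<or>
    (\<exists>j>B. j \<in> fired N \<and> (\<forall>x\<ge>B + 3. int (kspm_pi 3 (Suc N) x) =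
       int (kspm_pi 3 N x) - 2 * of_bool (x = j) + of_bool (x = j + 1) + of_bool (x = j + 2)))"
proof (cases "fired N \<inter> {B<..} = {}")
  case True
  then have "\<And>x. x > B \<Longrightarrow> x \<notin> fired N" by auto
  then have "\<forall>x\<ge>B + 3. int (kspm_pi 3 (Suc N) x) = int (kspm_pi 3 N x)"
    by (simp add: kspm_pi_Suc_int)
  then show ?thesis by simp
next
  case False
  define j where "j = Max (fired N \<inter> {B<..})"
  have fin: "finite (fired N \<inter> {B<..})" using avalanche_finite[OF fired(1)] by blast
  with False have j: "j \<in> fired N" "j > B" using Max_in[of "fired N \<inter> {B<..}"] by (auto simp: j_def)
  have mem: "x \<in> fired N \<longleftrightarrow> x \<le> j" if "x > B" for x
  proof
    show "x \<le> j" if "x \<in> fired N" using that \<open>x > B\<close> fin by (simp add: j_def)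
    show "x \<in> fired N" if "x \<le> j" using fired_interval[OF assms \<open>x > B\<close>] j(1) that by blast
  qed
  have "int (kspm_pi 3 (Suc N) x) =
      int (kspm_pi 3 N x) - 2 * of_bool (x = j) + of_bool (x = j + 1) + of_bool (x = j + 2)"
    if "x \<ge> B + 3" for x
  proof -
    \<comment> \<open>The offset 3 puts all columns that influence \<open>x\<close> beyond
      \<open>B\<close>, where the fired set is known.\<close>
    have "x - 2 > B" "x > B" "Suc x > B" "x \<noteq> 0" "2 \<le> x" using that by auto
    then show ?thesis by (auto simp: kspm_pi_Suc_int mem)
  qed
  with j show ?thesis by blast
qed

text \<open>The condition of at most one separating 0, in a form that can be followed through an
  avalanche without parsing blocks.\<close>

definition one_gap :: "nat \<Rightarrow> (nat \<Rightarrow> nat) \<Rightarrow> bool" where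
  "one_gap k s \<longleftrightarrow> (\<forall>x y z. k \<le> x \<and> x < y \<and> y \<le> z \<and> s x = 0 \<and> s y = 0 \<longrightarrow> s z = 0)"

lemma one_gap_step:
  assumes old: "confined B N"
    and new: "confined B (Suc N)"
    and gap: "one_gap (B + 3) (kspm_pi 3 N)"
  shows "one_gap (B + 3) (kspm_pi 3 (Suc N))"
proof -
  let ?s = "kspm_pi 3 N" and ?t = "kspm_pi 3 (Suc N)"
  from avalanche_effect[OF old new] show ?thesis
  proof (elim disjE exE conjE)
    assume eq: "\<forall>x\<ge>B + 3. ?t x = ?s x"
    show ?thesis
      unfolding one_gap_def
    proof (intro allI impI, elim conjE)
      fix x y z assume *: "B + 3 \<le> x" "x < y" "y \<le> z" "?t x = 0" "?t y = 0"
      then have "?s x = 0" "?s y = 0" using eq by simp_all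
      then have "?s z = 0" using gap * unfolding one_gap_def by blast
      then show "?t z = 0" using eq * by simp
    qed
  next
    fix j
    assume j: "j > B" "j \<in> fired N"
      and eff: "\<forall>x\<ge>B + 3. int (?t x) =
        int (?s x) - 2 * of_bool (x = j) + of_bool (x = j + 1) + of_bool (x = j + 2)"
    have t: "?t x = ?s x" if "x \<ge> B + 3" "x \<notin> {j, j + 1, j + 2}" for x
      using eff that by auto
    have nz: "?t x \<noteq> 0" if "x \<ge> B + 3" "x = j + 1 \<or> x = j + 2" for x
      using eff that by auto
    \<comment> \<open>The avalanche stops before every zero of the old tail.\<close>
    have zero_late: "x > j + 1" if "x \<ge> B + 3" "?s x = 0" for x
    proof -
      have "fired N \<inter> {Suc (x - 2)..} = {}"
        using fired_stops_before_zero[OF old, of "x - 2"] that by (simp add: Suc_diff_Suc numeral_2_eq_2)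
      then show ?thesis using j(2) that(1) by fastforce
    qed
    \<comment> \<open>To lose 2, column \<open>j\<close> held 2, so \<open>j + 1\<close> held 1.
      Afterwards \<open>j + 1\<close> holds 2, so \<open>j + 2\<close> must hold 1, one more than
      before: \<open>2,1,0\<close> became \<open>0,2,1\<close>.\<close>
    have hole: "?s (j + 2) = 0" if "j \<ge> B + 3"
    proof -
      have tj: "int (?t j) = int (?s j) - 2" "int (?t (j + 1)) = int (?s (j + 1)) + 1"
        "int (?t (j + 2)) = int (?s (j + 2)) + 1" using eff that by auto
      have "?s j = 2" using tj(1) kspm_pi_le_2[of N j] by linarith
      then have "curv N j = -1" using confined_cases[OF old, of "j - 1"] that by auto
      then have "?s (j + 1) = 1" using confined_cases[OF old, of j] that by auto
      then have "?t (j + 1) = 2" using tj(2) by simp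
      then have "curv (Suc N) (j + 1) = -1" using confined_cases[OF new, of j] that by auto
      then have "?t (j + 2) = 1" using confined_cases[OF new, of "j + 1"] that by auto
      then show ?thesis using tj(3) by simp
    qed
    show ?thesis
      unfolding one_gap_def
    proof (intro allI impI, elim conjE)
      fix x y z assume *: "B + 3 \<le> x" "x < y" "y \<le> z" "?t x = 0" "?t y = 0"
      have xy: "x \<notin> {j + 1, j + 2}" "y \<notin> {j + 1, j + 2}" using nz[of x] nz[of y] * by auto
      have "y \<noteq> j"
      proof
        assume "y = j"
        then have "?s x = 0" using t[of x] * by auto
        then show False using zero_late[of x] * \<open>y = j\<close> by simp
      qed
      then have sy: "?s y = 0" "y > j + 2" using t[of y] xy zero_late[of y] * by auto
      \<comment> \<open>An old zero before \<open>y\<close> is \<open>x\<close> itself or, if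
        \<open>x\<close> is the new zero at \<open>j\<close>, the hole at \<open>j + 2\<close> that
        it replaces.\<close>
      have "\<exists>x'. B + 3 \<le> x' \<and> x' < y \<and> ?s x' = 0"
      proof (cases "x = j")
        case True
        then show ?thesis using hole sy * by (intro exI[of _ "j + 2"]) auto
      next
        case False
        then show ?thesis using t[of x] xy * by (intro exI[of _ x]) auto
      qed
      then have "?s z = 0" using gap sy * unfolding one_gap_def by blast
      then show "?t z = 0" using t[of z] * sy by auto
    qed
  qed
qed

lemma one_gap_kspm_pi:
  assumes "\<And>n. n \<le> N \<Longrightarrow> confined B n"
  shows "one_gap (B + 3) (kspm_pi 3 N)"
proof -
  have "n \<le> N \<Longrightarrow> one_gap (B + 3) (kspm_pi 3 n)" for n
  proof (induction n)
    case 0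
    show ?case by (simp add: one_gap_def kspm_pi_0)
  next
    case (Suc n)
    then show ?case using assms by (intro one_gap_step) auto
  qed
  then show ?thesis by simp
qed

section \<open>Recognising the wave pattern\<close>

text \<open>A local description of infinite concatenations of the blocks \<open>2,1\<close> and
  \<open>0\<close>; \<open>s 0 \<noteq> 1\<close> prevents a start in the middle of a block.\<close>

definition blocks :: "(nat \<Rightarrow> nat) \<Rightarrow> bool" where
  "blocks s \<longleftrightarrow> s 0 \<noteq> 1 \<and> (\<forall>j. s j \<le> 2 \<and> (s j = 2 \<longleftrightarrow> s (Suc j) = 1))"

lemma blocks_cases:
  assumes "blocks s"
  obtains "s 0 = 0" "blocks (\<lambda>j. s (Suc j))"
  | "s 0 = 2" "s 1 = 1" "blocks (\<lambda>j. s (Suc (Suc j)))"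
proof -
  have s: "s 0 \<noteq> 1" "\<And>j. s j \<le> 2" "\<And>j. s j = 2 \<longleftrightarrow> s (Suc j) = 1"
    using assms by (auto simp: blocks_def)
  consider "s 0 = 0" | "s 0 = 2" using s(1) s(2)[of 0] by linarith
  then show thesis
  proof cases
    case 1
    then show thesis using s s(3)[of 0] by (intro that(1)) (auto simp: blocks_def)
  next
    case 2
    then have "s 1 = 1" using s(3)[of 0] by simp
    then show thesis using 2 s s(3)[of 1] by (intro that(2)) (auto simp: blocks_def)
  qed
qed

lemma nth_default_block:
  fixes s :: "nat \<Rightarrow> nat"
  assumes "s 0 = 2" "s 1 = 1" "(\<lambda>j. s (Suc (Suc j))) = nth_default 0 w"
  shows "s = nth_default 0 ([2, 1] @ w)"
proof
  fix j
  show "s j = nth_default 0 ([2, 1] @ w) j"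
    using assms fun_cong[OF assms(3)]
    by (cases j rule: nat.exhaust; cases "j - 1" rule: nat.exhaust) auto
qed

lemma blocks_no_gap:
  assumes "blocks s" "\<And>x z. x \<le> z \<Longrightarrow> s x = 0 \<Longrightarrow> s z = 0" "\<And>j. j \<ge> n \<Longrightarrow> s j = 0"
  shows "\<exists>m. s = nth_default 0 (concat (replicate m [2, 1]))"
  using assms
proof (induction n arbitrary: s rule: less_induct)
  case (less n)
  from less.prems(1) show ?case
  proof (cases rule: blocks_cases)
    case 1
    then have "s = nth_default 0 (concat (replicate 0 [2, 1]))" using less.prems(2)[of 0] by auto
    then show ?thesis ..
  next
    case 2
    then have "n > 0" using less.prems(3)[of 0] by (cases n) auto
    have "\<exists>m. (\<lambda>j. s (Suc (Suc j))) = nth_default 0 (concat (replicate m [2, 1]))"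
    proof (rule less.IH[of "n - 1"])
      show "s (Suc (Suc z)) = 0" if "x \<le> z" "s (Suc (Suc x)) = 0" for x z
        using less.prems(2)[of "Suc (Suc x)" "Suc (Suc z)"] that by simp
    qed (use \<open>n > 0\<close> 2 less.prems(3) in auto)
    then obtain m where "(\<lambda>j. s (Suc (Suc j))) = nth_default 0 (concat (replicate m [2, 1]))" ..
    then have "s = nth_default 0 (concat (replicate (Suc m) [2, 1]))"
      using nth_default_block 2 by simp
    then show ?thesis ..
  qed
qed

text \<open>Peel off blocks \<open>2,1\<close> up to the first 0. Behind it any further 0 ends the
  pile, so \<open>blocks_no_gap\<close> applies to the rest.\<close>

lemma blocks_one_gap:
  assumes "blocks s" "one_gap 0 s" "\<And>j. j \<ge> n \<Longrightarrow> s j = 0"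
  shows "s \<in> wave_pattern"
  using assms
proof (induction n arbitrary: s rule: less_induct)
  case (less n)
  from less.prems(1) show ?case
  proof (cases rule: blocks_cases)
    case 1
    have "\<exists>m. (\<lambda>j. s (Suc j)) = nth_default 0 (concat (replicate m [2, 1]))"
    proof (rule blocks_no_gap[of _ n])
      show "s (Suc z) = 0" if "x \<le> z" "s (Suc x) = 0" for x z
        using less.prems(2) 1(1) that unfolding one_gap_def
        by (metis Suc_le_mono le0 zero_less_Suc)
    qed (use 1 less.prems(3) in auto)
    then obtain m where m: "(\<lambda>j. s (Suc j)) = nth_default 0 (concat (replicate m [2, 1]))" ..
    \<comment> \<open>If only zeros follow, \<open>m\<close> is 0 and the recorded separator merges
      with them, so \<open>e = 1\<close> also covers the case of no gap.\<close>
    have "s j = nth_default 0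
        (concat (replicate 0 [2, 1]) @ replicate 1 0 @ concat (replicate m [2, 1])) j" for j
      using 1(1) fun_cong[OF m] by (cases j) auto
    then have "s = nth_default 0
        (concat (replicate 0 [2, 1]) @ replicate 1 0 @ concat (replicate m [2, 1]))" ..
    then show ?thesis unfolding wave_pattern_def by blast
  next
    case 2
    then have "n > 0" using less.prems(3)[of 0] by (cases n) auto
    have "(\<lambda>j. s (Suc (Suc j))) \<in> wave_pattern"
    proof (rule less.IH[of "n - 1"])
      show "one_gap 0 (\<lambda>j. s (Suc (Suc j)))"
        using less.prems(2) unfolding one_gap_def by (metis Suc_le_mono Suc_less_eq le0)
    qed (use \<open>n > 0\<close> 2 less.prems(3) in auto)
    then obtain m e m' where "e \<le> 1" and w: "(\<lambda>j. s (Suc (Suc j))) = nth_default 0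
        (concat (replicate m [2, 1]) @ replicate e 0 @ concat (replicate m' [2, 1]))"
      unfolding wave_pattern_def by blast
    have "s = nth_default 0
        (concat (replicate (Suc m) [2, 1]) @ replicate e 0 @ concat (replicate m' [2, 1]))"
      using nth_default_block[OF 2(1,2) w] by simp
    with \<open>e \<le> 1\<close> show ?thesis unfolding wave_pattern_def by blast
  qed
qed

lemma one_gap_tail:
  assumes "one_gap k s" "k \<le> i"
  shows "one_gap 0 (tail_from i s)"
  unfolding one_gap_def tail_from_def
proof (intro allI impI, elim conjE)
  fix x y z assume "x < y" "y \<le> z" "s (i + x) = 0" "s (i + y) = 0"
  moreover from this have "k \<le> i + x" "i + x < i + y" "i + y \<le> i + z" using assms(2) by auto
  ultimately show "s (i + z) = 0" using assms(1) unfolding one_gap_def by blast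
qed

lemma tail_wave_pattern:
  assumes "\<And>n. n \<le> N \<Longrightarrow> confined B n"
  shows "\<exists>i\<le>B + 4. tail_from i (kspm_pi 3 N) \<in> wave_pattern"
proof -
  let ?s = "kspm_pi 3 N"
  have curv: "confined B N" using assms by blast
  \<comment> \<open>Start one column later if \<open>B + 3\<close> is the second half of a block;
    two adjacent 1s cannot occur.\<close>
  obtain i where i: "B + 3 \<le> i" "i \<le> B + 4" "?s i \<noteq> 1"
  proof (cases "?s (B + 3) = 1")
    case True
    then have "?s (B + 4) \<noteq> 1"
      using confined_cases[OF curv, of "B + 2"] confined_cases[OF curv, of "B + 3"]
      by (auto simp: numeral_eq_Suc)
    then show thesis by (intro that[of "B + 4"]) auto
  next
    case False
    then show thesis by (intro that[of "B + 3"]) auto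
  qed
  have "blocks (tail_from i ?s)"
    unfolding blocks_def tail_from_def
  proof (intro conjI allI)
    fix j
    have "i + j = Suc (i + j - 1)" "B \<le> i + j - 1" using i by auto
    then show "(?s (i + j) = 2) = (?s (i + Suc j) = 1)"
      using confined_cases[OF curv, of "i + j - 1"]
        confined_cases[OF curv, of "i + j"] by auto
  qed (use i kspm_pi_le_2 in auto)
  moreover have "one_gap 0 (tail_from i ?s)"
    using one_gap_kspm_pi[OF assms] i(1) by (rule one_gap_tail)
  moreover obtain n where "\<forall>j\<ge>n. ?s j = 0"
    using configuration_kspm_pi unfolding configuration_def by blast
  then have "\<And>j. j \<ge> n \<Longrightarrow> tail_from i ?s j = 0" by (simp add: tail_from_def)
  ultimately have "tail_from i ?s \<in> wave_pattern" by (rule blocks_one_gap)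
  with i(2) show ?thesis by blast
qed

section \<open>The logarithmic bound\<close>

lemma confined_floorlog:
  assumes "n \<le> N"
  shows "confined (floorlog 2 N + 4) n"
  unfolding confined_def
proof (intro allI impI)
  fix j assume j: "j \<ge> floorlog 2 N + 4"
  have "n < 2 ^ floorlog 2 N"
    using floorlog_bounds[of N 2] assms(1) by (cases "N = 0") auto
  then have "2 * n < 2 ^ (floorlog 2 N + 1)" by simp
  also have "\<dots> \<le> 2 ^ (j - 3)" using j by (intro power_increasing) auto
  \<comment> \<open>The 4 in the cut-off is 1 for the factor 2 in \<open>2 * n\<close> and 3 for the
    columns that \<open>curv_confined\<close> uses up.\<close>
  finally have "curv n (Suc (Suc (Suc (j - 3)))) \<in> {-1, 0}" by (rule curv_confined)
  moreover have "Suc (Suc (Suc (j - 3))) = j" using j by simp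
  ultimately show "curv n j \<in> {-1, 0}" by simp
qed

lemma floorlog_bigo: "(\<lambda>N. real (floorlog 2 N + c)) \<in> O(\<lambda>N. ln (real N))"
proof (rule bigoI)
  show "\<forall>\<^sub>F N in sequentially. norm (real (floorlog 2 N + c)) \<le> (2 + c) / ln 2 * norm (ln (real N))"
    using eventually_ge_at_top[of 2]
  proof eventually_elim
    case (elim N)
    \<comment> \<open>From \<open>N = 2\<close> on the logarithm is at least 1 and absorbs the
      constant \<open>1 + c\<close>.\<close>
    have l: "1 \<le> log 2 (real N)" using elim by simp
    have "real (floorlog 2 N) \<le> log 2 (real N) + 1"
      using elim l by (simp add: floorlog_def)
    moreover have "1 + real c \<le> (1 + real c) * log 2 (real N)"
      using mult_left_mono[OF l, of "1 + real c"] by simp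
    ultimately have "real (floorlog 2 N + c) \<le> (2 + real c) * log 2 (real N)"
      by (simp add: algebra_simps)
    also have "\<dots> = (2 + c) / ln 2 * norm (ln (real N))" using elim by (simp add: log_def)
    finally show ?case by simp
  qed
qed

theorem theorem1:
  shows "\<exists>i :: nat \<Rightarrow> nat.
           (\<lambda>N. real (i N)) \<in> O(\<lambda>N. ln (real N)) \<and>
           (\<forall>N. tail_from (i N) (kspm_pi 3 N) \<in> wave_pattern)"
proof -
  \<comment> \<open>Here 8 = 4 + 4: the offset of the cut-off plus that of
    \<open>tail_wave_pattern\<close>.\<close>
  have "\<forall>N. \<exists>i\<le>floorlog 2 N + 8. tail_from i (kspm_pi 3 N) \<in> wave_pattern"
  proof
    fix N
    show "\<exists>i\<le>floorlog 2 N + 8. tail_from i (kspm_pi 3 N) \<in> wave_pattern"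
      using tail_wave_pattern[of N "floorlog 2 N + 4", OF confined_floorlog] by (simp add: add.commute)
  qed
  then obtain i where i: "\<And>N. i N \<le> floorlog 2 N + 8"
      "\<And>N. tail_from (i N) (kspm_pi 3 N) \<in> wave_pattern" by metis
  have "(\<lambda>N. real (i N)) \<in> O(\<lambda>N. real (floorlog 2 N + 8))"
    using i(1) by (intro bigoI[of _ 1] always_eventually) (auto simp del: of_nat_add)
  then have "(\<lambda>N. real (i N)) \<in> O(\<lambda>N. ln (real N))"
    using floorlog_bigo by (rule landau_o.big_trans)
  with i(2) show ?thesis by blast
qed

end
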